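(* Let $\tilde{x}_k$ be the $k$-th iterate of the randomized extended Kaczmarz (REK) method applied to the doubly noisy linear system $\widetilde{A}x=\tilde{b}$. Let $x_{LS}=A^{\dagger}b$ and $\tilde{x}_{LS}=\widetilde{A}^{\dagger}\tilde{b}$ be the least-squares solutions of the noiseless system $Ax=b$ and of the doubly noisy system $\widetilde{A}x=\tilde{b}$, respectively. Then for any $\tilde{x}_0\in\mathbb{R}^n$ and any positive integer $k$, $$\|\mathbb{E}(\tilde{x}_k-x_{LS})\|_2\le\alpha^k\left\|(\tilde{x}_0-x_{LS})_{\mathcal{R}(\widetilde{A}^{\top})}\right\|_2+k\alpha^{k-1}\frac{\|\widetilde{A}^{\top}\tilde{b}\|_2}{\|\widetilde{A}\|_F^2}+\beta\left\|(x_{LS}-\tilde{x}_{LS})_{\mathcal{R}(\widetilde{A}^{\top})}\right\|_2+\left\|(\tilde{x}_0-x_{LS})_{\mathcal{N}(\widetilde{A})}\right\|_2,$$ where $\alpha=1-\frac{\sigma_{\min}^2(\widetilde{A})}{\|\widetilde{A}\|_F^2}$ and $\beta=1-\left(1-\frac{\sigma_{\max}^2(\widetilde{A})}{\|\widetilde{A}\|_F^2}\right)^k$.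
   Context: $A,\widetilde{A}\in\mathbb{R}^{m\times n}$ and $b,\tilde{b}\in\mathbb{R}^m$ are fixed (deterministic), $\widetilde{A}\neq 0$; $\widetilde{A},\tilde{b}$ are noisy versions of $A,b$. Neither $Ax=b$ nor $\widetilde{A}x=\tilde{b}$ is assumed consistent. $M^{\dagger}$ is the Moore-Penrose inverse, $\mathcal{R}(\cdot)$ and $\mathcal{N}(\cdot)$ denote range and null space, $\|\cdot\|_F$ is the Frobenius norm, $\sigma_{\min}(\widetilde{A})$ is the smallest nonzero singular value and $\sigma_{\max}(\widetilde{A})$ the largest singular value of $\widetilde{A}$, and $(x)_{V}$ is the (Euclidean) orthogonal projection of $x$ onto the subspace $V$. REK method: let $\tilde{a}_i^{\top}$ be the $i$-th row and $\bar{a}_j$ the $j$-th column of $\widetilde{A}$, and $\tilde{b}_i$ the $i$-th entry of $\tilde{b}$. Start from $\tilde{x}_0$ and $\tilde{z}_0=\tilde{b}$. At step $k=1,2,\dots$ a column index $j_k\in\{1,\dots,n\}$ is drawn with probability $\mathbb{P}(j_k=j)=\|\bar{a}_j\|_2^2/\|\widetilde{A}\|_F^2$ and a row index $i_k\in\{1,\dots,m\}$ is drawn with probability $\mathbb{P}(i_k=i)=\|\tilde{a}_i\|_2^2/\|\widetilde{A}\|_F^2$ (all draws independent), and $$\tilde{z}_k=\tilde{z}_{k-1}-\frac{\bar{a}_{j_k}^{\top}\tilde{z}_{k-1}}{\|\bar{a}_{j_k}\|_2^2}\,\bar{a}_{j_k},\qquad \tilde{x}_k=\tilde{x}_{k-1}-\frac{\tilde{a}_{i_k}^{\top}\tilde{x}_{k-1}-\tilde{b}_{i_k}+(\tilde{z}_{k-1})_{i_k}}{\|\tilde{a}_{i_k}\|_2^2}\,\tilde{a}_{i_k},$$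 where $(\tilde{z}_{k-1})_{i}$ is the $i$-th entry of $\tilde{z}_{k-1}$. $\mathbb{E}$ denotes expectation over all random index choices. *)

theory Defs
  imports "HOL-Probability.Probability"
begin

section \<open>Matrices\<close>

text \<open>On \<open>real ^ 'n ^ 'm\<close> the library norm is the \<open>\<ell>\<^sub>2\<close> norm of the vector of Euclidean norms of
  the rows, which is the Frobenius norm (and not the operator norm).\<close>

abbreviation frobenius_norm :: "real ^ 'n ^ 'm \<Rightarrow> real"
  where "frobenius_norm A \<equiv> norm A"

lemma frobenius_norm_eq:
  fixes A :: "real ^ 'n ^ 'm"
  shows "frobenius_norm A = sqrt (\<Sum>i\<in>UNIV. \<Sum>j\<in>UNIV. (A $ i $ j)\<^sup>2)"
  by (simp add: norm_vec_def L2_set_def sum_nonneg)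

definition range_space :: "real ^ 'n ^ 'm \<Rightarrow> (real ^ 'm) set"
  where "range_space A = range (\<lambda>x. A *v x)"

definition null_space :: "real ^ 'n ^ 'm \<Rightarrow> (real ^ 'n) set"
  where "null_space A = {x. A *v x = 0}"

definition orth_proj :: "(real ^ 'n) set \<Rightarrow> real ^ 'n \<Rightarrow> real ^ 'n"
  where "orth_proj V x = (THE p. p \<in> V \<and> (\<forall>v\<in>V. orthogonal (x - p) v))"

lemma orth_proj_ex1:
  fixes V :: "(real ^ 'n) set"
  assumes V: "subspace V"
  shows "\<exists>!p. p \<in> V \<and> (\<forall>v\<in>V. orthogonal (x - p) v)"
proof -
  obtain y z where y: "y \<in> span V" and z: "\<And>w. w \<in> span V \<Longrightarrow> orthogonal z w" and x: "x = y + z"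
    using orthogonal_subspace_decomp_exists[of V x] by metis
  have sp: "span V = V" using V by (simp add: span_eq_iff)
  show ?thesis
  proof (rule ex1I[of _ y])
    show "y \<in> V \<and> (\<forall>v\<in>V. orthogonal (x - y) v)" using y z x sp by simp
  next
    fix p assume p: "p \<in> V \<and> (\<forall>v\<in>V. orthogonal (x - p) v)"
    have d: "y - p \<in> V" using p y sp V by (simp add: subspace_diff)
    have "(x - p) \<bullet> (y - p) = 0" "(x - y) \<bullet> (y - p) = 0"
      using p d z x sp by (auto simp: orthogonal_def)
    then have "(y - p) \<bullet> (y - p) = 0" by (simp add: inner_diff_left)
    then show "p = y" by simp
  qed
qed

lemma inner_matrix_transpose:
  fixes A :: "real ^ 'n ^ 'm"
  shows "(A *v x) \<bullet> y = x \<bullet> (transpose A *v y)"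
  using dot_lmul_matrix[of y A x]
  by (simp add: inner_commute)

lemma subspace_range_space: "subspace (range_space A)"
  unfolding range_space_def
  by (rule linear_subspace_image[OF matrix_vector_mul_linear subspace_UNIV])

lemma subspace_null_space: "subspace (null_space A)"
  unfolding null_space_def
  by (rule linear_subspace_kernel[OF matrix_vector_mul_linear])

text \<open>The Moore-Penrose inverse, as the unique solution of the four Penrose equations.\<close>

definition is_pinv :: "real ^ 'n ^ 'm \<Rightarrow> real ^ 'm ^ 'n \<Rightarrow> bool"
  where "is_pinv A X \<longleftrightarrow>
    A ** X ** A = A \<and> X ** A ** X = X \<and>
    transpose (A ** X) = A ** X \<and> transpose (X ** A) = X ** A"

definition pinv :: "real ^ 'n ^ 'm \<Rightarrow> real ^ 'm ^ 'n"
  where "pinv A = (THE X. is_pinv A X)"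

lemma is_pinv_unique:
  assumes X: "is_pinv A X" and Y: "is_pinv A Y"
  shows "X = Y"
proof -
  have "A ** X = (A ** Y) ** (A ** X)"
    using Y by (metis is_pinv_def matrix_mul_assoc)
  then have "A ** X = transpose ((A ** Y) ** (A ** X))"
    using X by (metis is_pinv_def)
  also have "\<dots> = (A ** X) ** (A ** Y)"
    using X Y by (metis is_pinv_def matrix_transpose_mul)
  also have "\<dots> = A ** Y"
    using X by (metis is_pinv_def matrix_mul_assoc)
  finally have AX: "A ** X = A ** Y" .
  have "X ** A = (X ** A) ** (Y ** A)"
    using Y by (metis is_pinv_def matrix_mul_assoc)
  then have "X ** A = transpose ((X ** A) ** (Y ** A))"
    using X by (metis is_pinv_def)
  also have "\<dots> = (Y ** A) ** (X ** A)"
    using X Y by (metis is_pinv_def matrix_transpose_mul)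
  also have "\<dots> = Y ** A"
    using X by (metis is_pinv_def matrix_mul_assoc)
  finally have XA: "X ** A = Y ** A" .
  show ?thesis
    using X Y AX XA by (metis is_pinv_def matrix_mul_assoc)
qed

lemma symmetric_matrixI:
  fixes B :: "real ^ 'n ^ 'n"
  assumes "\<And>x y. (B *v x) \<bullet> y = x \<bullet> (B *v y)"
  shows "transpose B = B"
proof -
  have "x \<bullet> (transpose B *v y - B *v y) = 0" for x y
    using assms[of x y] by (simp add: inner_matrix_transpose inner_diff_right)
  then have "transpose B *v y = B *v y" for y
    by (metis inner_eq_zero_iff eq_iff_diff_eq_0)
  then show ?thesis by (simp add: matrix_eq)
qed

lemma is_pinv_exists:
  fixes A :: "real ^ 'n ^ 'm"
  shows "\<exists>X. is_pinv A X"
proof -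
  define P where "P b x \<longleftrightarrow> x \<in> range_space (transpose A) \<and> transpose A *v (A *v x - b) = 0"
    for b x
  have orth: "(A *v x) \<bullet> (A *v y - b) = 0" if "P b y" for b x y
    using that by (simp add: P_def inner_matrix_transpose)
  have ex: "\<exists>x. P b x" for b
  proof -
    obtain p where p: "p \<in> range_space A" "\<And>v. v \<in> range_space A \<Longrightarrow> orthogonal (b - p) v"
      using orth_proj_ex1[OF subspace_range_space] by metis
    obtain y where y: "p = A *v y" using p(1) by (auto simp: range_space_def)
    obtain x where x: "x \<in> range_space (transpose A)"
        "\<And>v. v \<in> range_space (transpose A) \<Longrightarrow> orthogonal (y - x) v"
      using orth_proj_ex1[OF subspace_range_space] by metis
    have "(A *v (y - x)) \<bullet> w = 0" for w
      using x(2) by (auto simp: inner_matrix_transpose orthogonal_def range_space_def)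
    then have "A *v (y - x) = 0" by (metis inner_eq_zero_iff)
    then have "A *v x = p" using y by (simp add: matrix_vector_mult_diff_distrib)
    moreover have "w \<bullet> (transpose A *v (p - b)) = 0" for w
    proof -
      have "(b - p) \<bullet> (A *v w) = 0"
        using p(2) by (auto simp: orthogonal_def range_space_def)
      then have "(A *v w) \<bullet> (p - b) = 0"
        by (simp add: inner_commute inner_diff_left inner_diff_right)
      then show ?thesis by (simp add: inner_matrix_transpose)
    qed
    ultimately show ?thesis using x(1) unfolding P_def by (metis inner_eq_zero_iff)
  qed
  have uniq: "x = y" if x: "P b x" and y: "P b y" for b x y
  proof -
    have "transpose A *v (A *v (x - y)) = 0"
      using x y by (simp add: P_def matrix_vector_mult_diff_distrib)
    then have "(A *v (x - y)) \<bullet> (A *v (x - y)) = 0"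
      by (simp only: inner_matrix_transpose) simp
    then have A0: "A *v (x - y) = 0" by simp
    have "x - y \<in> range_space (transpose A)"
      using x y by (simp add: P_def subspace_diff subspace_range_space)
    then obtain w where w: "x - y = transpose A *v w" by (auto simp: range_space_def)
    have "(x - y) \<bullet> (x - y) = 0"
      using inner_matrix_transpose[of A "x - y" w] A0 w by simp
    then show ?thesis by simp
  qed
  define g where "g b = (SOME x. P b x)" for b
  have g: "P b (g b)" for b unfolding g_def using ex by (rule someI_ex)
  have "linear g"
  proof (rule linearI)
    fix b c
    have "g b + g c \<in> range_space (transpose A)"
      using g[of b] g[of c] by (simp add: P_def subspace_add subspace_range_space)
    then have "P (b + c) (g b + g c)"
      using g[of b] g[of c]
      by (simp add: P_def algebra_simps matrix_vector_mult_diff_distrib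
            matrix_vector_right_distrib)
    then show "g (b + c) = g b + g c" using uniq g by blast
  next
    fix r :: real and b
    have "r *\<^sub>R g b \<in> range_space (transpose A)"
      using g[of b] by (simp add: P_def subspace_scale subspace_range_space)
    then have "P (r *\<^sub>R b) (r *\<^sub>R g b)"
      using g[of b]
      by (simp add: P_def matrix_vector_mult_diff_distrib matrix_vector_mult_scaleR)
    then show "g (r *\<^sub>R b) = r *\<^sub>R g b" using uniq g by blast
  qed
  then have X: "matrix g *v b = g b" for b by (simp add: matrix_works)
  have gA: "A *v (g (A *v x)) = A *v x" for x
  proof -
    have "(A *v (g (A *v x) - x)) \<bullet> (A *v g (A *v x) - A *v x) = 0"
      using orth[OF g] by blast
    then show ?thesis by (simp add: matrix_vector_mult_diff_distrib)
  qed
  have "is_pinv A (matrix g)"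
    unfolding is_pinv_def
  proof (intro conjI)
    show "A ** matrix g ** A = A"
      by (simp add: matrix_eq X gA flip: matrix_vector_mul_assoc)
    have "g (A *v g b) = g b" for b
    proof (rule uniq[OF g])
      show "P (A *v g b) (g b)" using g[of b] by (simp add: P_def)
    qed
    then show "matrix g ** A ** matrix g = matrix g"
      by (simp add: matrix_eq X flip: matrix_vector_mul_assoc)
    show "transpose (A ** matrix g) = A ** matrix g"
    proof (rule symmetric_matrixI)
      fix b c
      have "(A *v g b) \<bullet> (A *v g c - c) = 0" "(A *v g c) \<bullet> (A *v g b - b) = 0"
        using orth[OF g] by blast+
      then show "((A ** matrix g) *v b) \<bullet> c = b \<bullet> ((A ** matrix g) *v c)"
        by (simp add: X inner_diff_right inner_commute flip: matrix_vector_mul_assoc)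
    qed
    show "transpose (matrix g ** A) = matrix g ** A"
    proof (rule symmetric_matrixI)
      fix x y
      have *: "(g (A *v u) - u) \<bullet> g b = 0" for u b
      proof -
        obtain w where w: "g b = transpose A *v w"
          using g[of b] by (auto simp: P_def range_space_def)
        have "A *v (g (A *v u) - u) = 0" by (simp add: gA matrix_vector_mult_diff_distrib)
        then show ?thesis using inner_matrix_transpose[of A "g (A *v u) - u" w] w by simp
      qed
      have "(g (A *v x) - x) \<bullet> g (A *v y) = 0" "(g (A *v y) - y) \<bullet> g (A *v x) = 0"
        using * by blast+
      then show "((matrix g ** A) *v x) \<bullet> y = x \<bullet> ((matrix g ** A) *v y)"
        by (simp add: X inner_diff_left inner_diff_right inner_commute flip: matrix_vector_mul_assoc)
    qed
  qed
  then show ?thesis by blast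
qed

lemma is_pinv_pinv: "is_pinv A (pinv A)"
  unfolding pinv_def using is_pinv_exists is_pinv_unique by (metis theI)

text \<open>Singular values: square roots of the eigenvalues of \<open>A\<^sup>T A\<close>.
  (If \<open>A\<close> is wide, this counts \<open>0\<close> as a singular value; that affects neither the largest nor
  the smallest nonzero one.)\<close>

definition singular_values :: "real ^ 'n ^ 'm \<Rightarrow> real set"
  where "singular_values A =
    {s. s \<ge> 0 \<and> (\<exists>v. v \<noteq> 0 \<and> (transpose A ** A) *v v = s\<^sup>2 *\<^sub>R v)}"

definition sigma_max :: "real ^ 'n ^ 'm \<Rightarrow> real"
  where "sigma_max A = Max (singular_values A)"

definition sigma_min :: "real ^ 'n ^ 'm \<Rightarrow> real"
  where "sigma_min A = Min (singular_values A - {0})"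

lemma finite_singular_values:
  fixes A :: "real ^ 'n ^ 'm"
  shows "finite (singular_values A)"
proof -
  have "\<forall>s \<in> singular_values A. \<exists>v. v \<noteq> 0 \<and> (transpose A ** A) *v v = s\<^sup>2 *\<^sub>R v"
    by (simp add: singular_values_def)
  then obtain e where e: "\<And>s. s \<in> singular_values A \<Longrightarrow>
      e s \<noteq> 0 \<and> (transpose A ** A) *v e s = s\<^sup>2 *\<^sub>R e s"
    by (metis bchoice)
  have orth: "e s \<bullet> e t = 0"
    if s: "s \<in> singular_values A" and t: "t \<in> singular_values A" and "s \<noteq> t" for s t
  proof -
    have "((transpose A ** A) *v e s) \<bullet> e t = e s \<bullet> ((transpose A ** A) *v e t)"
      by (simp add: inner_matrix_transpose matrix_transpose_mul del: transpose_matrix_vector)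
    then have "s\<^sup>2 * (e s \<bullet> e t) = t\<^sup>2 * (e s \<bullet> e t)" using e[OF s] e[OF t] by simp
    moreover have "s\<^sup>2 \<noteq> t\<^sup>2"
      using s t \<open>s \<noteq> t\<close> by (simp add: singular_values_def power2_eq_iff_nonneg)
    ultimately show ?thesis by simp
  qed
  have "inj_on e (singular_values A)"
    using orth e by (intro inj_onI) (metis inner_eq_zero_iff)
  moreover have "pairwise orthogonal (e ` singular_values A)"
    using orth by (force simp: pairwise_def orthogonal_def)
  then have "finite (e ` singular_values A)"
    using e by (intro finiteI_independent pairwise_orthogonal_independent) auto
  ultimately show ?thesis by (rule finite_imageD[rotated])
qed

lemma nonzero_singular_values_nonempty:
  fixes A :: "real ^ 'n ^ 'm"
  assumes "A \<noteq> 0"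
  shows "singular_values A - {0} \<noteq> {}"
proof -
  have "continuous_on (sphere 0 1) (\<lambda>x. norm (A *v x))"
    by (intro continuous_on_norm linear_continuous_on matrix_vector_mul_bounded_linear)
  moreover have "sphere (0 :: real ^ 'n) 1 \<noteq> {}" by simp
  ultimately obtain v where v: "norm v = 1"
    and max: "\<And>x. norm x = 1 \<Longrightarrow> norm (A *v x) \<le> norm (A *v v)"
    using continuous_attains_sup[of "sphere (0 :: real ^ 'n) 1"] by fastforce
  define s where "s = norm (A *v v)"
  have bd: "norm (A *v x) \<le> s * norm x" for x
  proof (cases "x = 0")
    case False
    then have "norm (A *v (x /\<^sub>R norm x)) \<le> s" using max[of "x /\<^sub>R norm x"] by (simp add: s_def)
    then show ?thesis using False by (simp add: matrix_vector_mult_scaleR field_simps)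
  qed simp
  have "s \<noteq> 0"
  proof
    assume "s = 0"
    then have "A *v x = 0" for x using bd[of x] by simp
    then show False using assms by (simp add: matrix_eq)
  qed
  define u where "u = transpose A *v (A *v v) - s\<^sup>2 *\<^sub>R v"
  have "norm u ^ 2 = norm (transpose A *v (A *v v)) ^ 2 - s ^ 4"
  proof -
    have "v \<bullet> (transpose A *v (A *v v)) = s\<^sup>2"
      by (metis inner_matrix_transpose power2_norm_eq_inner s_def)
    moreover have "v \<bullet> v = 1" using v by (simp add: norm_eq_1)
    ultimately show ?thesis
      unfolding u_def power2_norm_eq_inner
      by (simp add: inner_diff_left inner_diff_right inner_commute power2_eq_square eval_nat_numeral
          del: transpose_matrix_vector)
  qed
  moreover have "norm (transpose A *v (A *v v)) \<le> s\<^sup>2"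
  proof -
    define w where "w = transpose A *v (A *v v)"
    have "norm w ^ 2 = (A *v w) \<bullet> (A *v v)"
      unfolding power2_norm_eq_inner by (metis inner_matrix_transpose w_def)
    also have "\<dots> \<le> norm (A *v w) * s" unfolding s_def by (rule norm_cauchy_schwarz)
    also have "\<dots> \<le> (s * norm w) * s" by (intro mult_right_mono bd) (simp add: s_def)
    finally have "norm w * norm w \<le> s\<^sup>2 * norm w" by (simp add: power2_eq_square mult_ac)
    then show ?thesis unfolding w_def[symmetric]
      by (cases "norm w = 0") (auto simp: mult_le_cancel_right)
  qed
  then have "norm (transpose A *v (A *v v)) ^ 2 \<le> (s\<^sup>2)\<^sup>2" by (rule power_mono) simp
  ultimately have "norm u ^ 2 \<le> 0" by simp
  then have "u = 0" by simp
  then have "(transpose A ** A) *v v = s\<^sup>2 *\<^sub>R v"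
    by (simp add: u_def flip: matrix_vector_mul_assoc)
  moreover have "v \<noteq> 0" using v by auto
  moreover have "s \<ge> 0" by (simp add: s_def)
  ultimately have "s \<in> singular_values A" unfolding singular_values_def by blast
  then show ?thesis using \<open>s \<noteq> 0\<close> by blast
qed


section \<open>The randomized extended Kaczmarz method\<close>

text \<open>The iterates along fixed index sequences \<open>j\<close> (columns) and \<open>i\<close> (rows); entry \<open>k\<close> is used in
  step \<open>k = 1, 2, \<dots>\<close>, entry \<open>0\<close> is never used. An index of a zero row or column has probability \<open>0\<close>
  of being drawn, so the value of the update there (division by zero) is irrelevant.\<close>

primrec rek_z :: "real ^ 'n ^ 'm \<Rightarrow> real ^ 'm \<Rightarrow> (nat \<Rightarrow> 'n) \<Rightarrow> nat \<Rightarrow> real ^ 'm"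
  where
    "rek_z A b j 0 = b"
  | "rek_z A b j (Suc k) =
      (let z = rek_z A b j k; c = column (j (Suc k)) A
       in z - ((c \<bullet> z) / (norm c)\<^sup>2) *\<^sub>R c)"

primrec rek_x :: "real ^ 'n ^ 'm \<Rightarrow> real ^ 'm \<Rightarrow> real ^ 'n \<Rightarrow>
    (nat \<Rightarrow> 'n) \<Rightarrow> (nat \<Rightarrow> 'm) \<Rightarrow> nat \<Rightarrow> real ^ 'n"
  where
    "rek_x A b x0 j i 0 = x0"
  | "rek_x A b x0 j i (Suc k) =
      (let x = rek_x A b x0 j i k; z = rek_z A b j k; l = i (Suc k); r = row l A
       in x - ((r \<bullet> x - b $ l + z $ l) / (norm r)\<^sup>2) *\<^sub>R r)"

text \<open>\<open>J k\<close> and \<open>I k\<close> (\<open>k \<ge> 1\<close>) are the random column and row indices of step \<open>k\<close>. The sum type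
  merely puts all of them into a single family, so that joint independence of all the draws can
  be expressed by \<open>indep_vars\<close>.\<close>

locale rek_draws = prob_space M
  for M :: "'w measure" +
  fixes A :: "real ^ 'n ^ 'm" and J :: "nat \<Rightarrow> 'w \<Rightarrow> 'n" and I :: "nat \<Rightarrow> 'w \<Rightarrow> 'm"
  assumes indep_draws:
    "indep_vars (\<lambda>_. count_space UNIV)
      (\<lambda>s \<omega>. case s of Inl k \<Rightarrow> Inl (J k \<omega>) | Inr k \<Rightarrow> Inr (I k \<omega>))
      (Inl ` {1..} \<union> Inr ` {1..})"
    and prob_column:
    "k \<ge> 1 \<Longrightarrow> prob {\<omega> \<in> space M. J k \<omega> = j} = (norm (column j A))\<^sup>2 / (frobenius_norm A)\<^sup>2"
    and prob_row:
    "k \<ge> 1 \<Longrightarrow> prob {\<omega> \<in> space M. I k \<omega> = i} = (norm (row i A))\<^sup>2 / (frobenius_norm A)\<^sup>2"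

end

theory Submission
  imports Defs
begin

text \<open>Write \<open>F\<close> for the squared Frobenius norm of \<open>At\<close>, \<open>S = I - At\<^sup>T At / F\<close>, \<open>u = At\<^sup>T bt\<close>, and
  \<open>y = pinv At *v bt\<close>. The proof computes the mean iterate exactly and then estimates it on the
  eigenspaces of \<open>S\<close>.

  Each new index is independent of the past, and its probability is proportional to the squared norm
  of the row or column by which the update divides. Averaging the update over the new index therefore
  gives an affine map of the mean iterates: the mean of \<open>z\<close> is multiplied by \<open>I - At At\<^sup>T / F\<close>, so that
  \<open>At\<^sup>T E z\<^sub>k = S\<^sup>k u\<close>. Since \<open>At\<^sup>T At y = u\<close> (\<open>pinv_normal_equation\<close>), the mean error
  \<open>e\<^sub>k = E x\<^sub>k - y\<close> satisfies \<open>e\<^sub>k\<^sub>+\<^sub>1 = S e\<^sub>k - S\<^sup>k u / F\<close>. The forcing term is transported by the same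
  \<open>S\<close>, and \<open>expectation_X\<close> solves the recursion: \<open>e\<^sub>k = S\<^sup>k (x\<^sub>0 - y) - (k / F) S\<^sup>k\<^sup>-\<^sup>1 u\<close>.

  Replacing the reference point \<open>y\<close> by an arbitrary \<open>x\<^sub>L\<^sub>S\<close> gives
  \<open>E x\<^sub>k - x\<^sub>L\<^sub>S = S\<^sup>k (x\<^sub>0 - x\<^sub>L\<^sub>S) - (I - S\<^sup>k) (x\<^sub>L\<^sub>S - y) - (k / F) S\<^sup>k\<^sup>-\<^sup>1 u\<close>.
  Here \<open>S\<close> is the identity on the null space of \<open>At\<close> and preserves the row space, where its
  eigenvalues are \<open>1 - s\<^sup>2 / F\<close> for nonzero singular values \<open>s\<close>. These lie between
  \<open>1 - sigma_max\<^sup>2 / F \<ge> 0\<close> and \<open>\<alpha>\<close>, so on the row space \<open>S\<^sup>k\<close> has norm at most \<open>\<alpha>\<^sup>k\<close> and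
  \<open>I - S\<^sup>k\<close> norm at most \<open>\<beta>\<close> (\<open>mean_step_funpow_range_bounds\<close>, from the spectral theorem
  \<open>self_adjoint_eigenbasis_of_subspace\<close>). The vector \<open>u\<close> lies in the row space, and \<open>I - S\<^sup>k\<close>
  annihilates the null space; splitting \<open>x\<^sub>0 - x\<^sub>L\<^sub>S\<close> orthogonally and applying the triangle inequality
  yields the four terms of the bound.\<close>

section \<open>Orthonormal eigenbases of self-adjoint maps\<close>

text \<open>First-order optimality in one dimension: a quadratic that vanishes at \<open>0\<close> and is
  nowhere negative cannot have a linear term.\<close>

lemma nonneg_quadratic_linear_coeff_zero:
  fixes a c :: real
  assumes "\<And>t. 0 \<le> 2 * t * a + t\<^sup>2 * c"
  shows "a = 0"
proof (rule ccontr)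
  assume a: "a \<noteq> 0"
  have c: "c \<ge> 0" using assms[of 1] assms[of "-1"] by simp
  \<comment> \<open>A step of length about \<open>-a / c\<close> makes the linear term dominate; \<open>c + 1\<close> avoids dividing by
    \<open>c = 0\<close>.\<close>
  define d where "d = c + 1"
  have d: "d > 0" "c = d - 1" using c by (simp_all add: d_def)
  have "2 * (- a / d) * a + (- a / d)\<^sup>2 * c = - (a\<^sup>2 * (d + 1)) / d\<^sup>2"
    using d(1) unfolding d(2) by (simp add: field_simps power2_eq_square)
  also have "\<dots> < 0" using a d by (intro divide_neg_pos) simp_all
  finally show False using assms[of "- a / d"] by simp
qed

text \<open>The Rayleigh quotient attains its maximum \<open>c\<close> on the unit sphere of \<open>V\<close>, say at \<open>v\<close>. The
  form of \<open>P = c I - T\<close> is then nonnegative on \<open>V\<close> and vanishes at \<open>v\<close>, so perturbing \<open>v\<close> in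
  every direction of \<open>V\<close> shows that \<open>P v\<close> is orthogonal to \<open>V\<close>. As \<open>V\<close> is invariant, \<open>P v\<close> also
  lies in \<open>V\<close>, hence vanishes.\<close>

lemma self_adjoint_eigenvector_in_subspace:
  fixes T :: "'a::euclidean_space \<Rightarrow> 'a"
  assumes lin: "linear T" and sa: "\<And>x y. T x \<bullet> y = x \<bullet> T y"
    and V: "subspace V" and inv: "\<And>x. x \<in> V \<Longrightarrow> T x \<in> V" and ne: "x0 \<in> V" "x0 \<noteq> 0"
  obtains v c where "v \<in> V" "norm v = 1" "T v = c *\<^sub>R v"
proof -
  interpret T: linear T by (rule lin)
  let ?S = "sphere 0 1 \<inter> V"
  have "compact ?S" using V by (intro compact_Int_closed closed_subspace) auto
  moreover have "x0 /\<^sub>R norm x0 \<in> ?S" using ne V by (simp add: subspace_scale)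
  moreover have "continuous_on ?S (\<lambda>x. T x \<bullet> x)"
    by (intro continuous_intros linear_continuous_on linear_linear[THEN iffD2] lin)
  ultimately obtain v where v: "v \<in> ?S" and max: "\<And>x. x \<in> ?S \<Longrightarrow> T x \<bullet> x \<le> T v \<bullet> v"
    using continuous_attains_sup[of ?S "\<lambda>x. T x \<bullet> x"] by blast
  define c where "c = T v \<bullet> v"
  define P where "P x = c *\<^sub>R x - T x" for x
  have vv: "v \<bullet> v = 1" using v by (simp add: norm_eq_1)
  have psd: "0 \<le> P x \<bullet> x" if "x \<in> V" for x
  proof (cases "x = 0")
    case True then show ?thesis by simp
  next
    case False
    have "T (x /\<^sub>R norm x) \<bullet> (x /\<^sub>R norm x) \<le> c"
      unfolding c_def using False that V by (intro max) (simp add: subspace_scale)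
    then have "T x \<bullet> x \<le> c * (norm x)\<^sup>2"
      using False by (simp add: T.scaleR field_simps power2_eq_square)
    then show ?thesis by (simp add: P_def inner_diff_left power2_norm_eq_inner)
  qed
  have "P v \<bullet> w = 0" if w: "w \<in> V" for w
  proof (rule nonneg_quadratic_linear_coeff_zero)
    fix t
    have "0 \<le> P (v + t *\<^sub>R w) \<bullet> (v + t *\<^sub>R w)"
      using v w V by (intro psd) (simp add: subspace_add subspace_scale)
    also have "\<dots> = 2 * t * (P v \<bullet> w) + t\<^sup>2 * (P w \<bullet> w)"
      using vv sa[of v w]
      by (simp add: P_def T.add T.scaleR algebra_simps inner_commute c_def power2_eq_square)
    finally show "0 \<le> 2 * t * (P v \<bullet> w) + t\<^sup>2 * (P w \<bullet> w)" .
  qed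
  moreover have "P v \<in> V" using v V inv by (simp add: P_def subspace_diff subspace_scale)
  ultimately have "P v = 0" using inner_eq_zero_iff by blast
  then show ?thesis using that[of v c] v by (simp add: P_def)
qed

text \<open>The finite-dimensional spectral theorem. The statement concerns an arbitrary invariant
  subspace so that induction on the dimension works: the vectors of \<open>V\<close> orthogonal to an
  eigenvector again form an invariant subspace, by self-adjointness.\<close>

lemma self_adjoint_eigenbasis_of_subspace:
  fixes T :: "'a::euclidean_space \<Rightarrow> 'a"
  assumes lin: "linear T" and sa: "\<And>x y. T x \<bullet> y = x \<bullet> T y"
    and "subspace V" and "\<And>x. x \<in> V \<Longrightarrow> T x \<in> V"
  shows "\<exists>B. finite B \<and> pairwise orthogonal B \<and> span B = V \<and>
    (\<forall>e\<in>B. norm e = 1 \<and> (\<exists>c. T e = c *\<^sub>R e))"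
  using assms(3,4)
proof (induction "dim V" arbitrary: V rule: less_induct)
  case less
  note V = \<open>subspace V\<close>
  show ?case
  proof (cases "V = {0}")
    case True
    then show ?thesis by (intro exI[of _ "{}"]) auto
  next
    case False
    then obtain x0 where "x0 \<in> V" "x0 \<noteq> 0" using V subspace_0 by blast
    then obtain v c where v: "v \<in> V" "norm v = 1" "T v = c *\<^sub>R v"
      using self_adjoint_eigenvector_in_subspace[OF lin sa V less.prems(2)] by metis
    have vv: "v \<bullet> v = 1" using v by (simp add: norm_eq_1)
    define W where "W = V \<inter> {y. v \<bullet> y = 0}"
    have W: "subspace W" unfolding W_def using V subspace_hyperplane by (rule subspace_inter)
    have "v \<notin> W" using vv by (simp add: W_def)
    then have "W \<subset> V" using v(1) unfolding W_def by blast
    then have "dim W < dim V" using V W by (intro dim_psubset) (simp add: span_eq_iff[THEN iffD2])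
    moreover have "T y \<in> W" if "y \<in> W" for y
      using that less.prems(2) sa[of v y] v(3) by (simp add: W_def)
    ultimately obtain B where B: "finite B" "pairwise orthogonal B" "span B = W"
      "\<forall>e\<in>B. norm e = 1 \<and> (\<exists>c. T e = c *\<^sub>R e)" using less.hyps[OF _ W] by blast
    have "B \<subseteq> W" using B(3) span_superset by blast
    then have "pairwise orthogonal (insert v B)"
      using B(2) by (auto simp: pairwise_insert orthogonal_def W_def inner_commute)
    moreover have "span (insert v B) = V"
    proof
      show "span (insert v B) \<subseteq> V" using v(1) V \<open>B \<subseteq> W\<close> by (intro span_minimal) (auto simp: W_def)
      show "V \<subseteq> span (insert v B)"
      proof
        fix x assume "x \<in> V"
        then have "x - (v \<bullet> x) *\<^sub>R v \<in> W"
          using v V vv by (simp add: W_def subspace_diff subspace_scale inner_diff_right)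
        then show "x \<in> span (insert v B)" unfolding span_insert B(3)[symmetric] by blast
      qed
    qed
    ultimately show ?thesis using B v by (intro exI[of _ "insert v B"]) auto
  qed
qed

text \<open>In an orthonormal eigenbasis \<open>T\<close> multiplies the coordinates by the eigenvalues, so by Parseval
  the norm of \<open>T v\<close> is controlled by the eigenvalues at those basis vectors that occur in \<open>v\<close>.
  Restricting the bound to these is what later excludes the eigenvalues belonging to the null
  space.\<close>

lemma norm_le_of_orthonormal_eigenbasis:
  fixes T :: "'a::euclidean_space \<Rightarrow> 'a"
  assumes lin: "linear T" and B: "finite B" "pairwise orthogonal B" "\<And>e. e \<in> B \<Longrightarrow> norm e = 1"
    and sp: "v \<in> span B" and eig: "\<And>e. e \<in> B \<Longrightarrow> T e = \<mu> e *\<^sub>R e"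
    and bd: "\<And>e. e \<in> B \<Longrightarrow> v \<bullet> e \<noteq> 0 \<Longrightarrow> \<bar>\<mu> e\<bar> \<le> m" and m: "m \<ge> 0"
  shows "norm (T v) \<le> m * norm v"
proof -
  interpret T: linear T by (rule lin)
  have v: "v = (\<Sum>e\<in>B. (v \<bullet> e) *\<^sub>R e)"
    using orthonormal_basis_expand[OF B(2,3) sp B(1)] by simp
  have parseval: "(norm (\<Sum>e\<in>B. f e *\<^sub>R e))\<^sup>2 = (\<Sum>e\<in>B. (f e)\<^sup>2)" for f :: "'a \<Rightarrow> real"
  proof -
    have "pairwise (\<lambda>i j. orthogonal (f i *\<^sub>R i) (f j *\<^sub>R j)) B"
      using B(2) by (auto simp: pairwise_def orthogonal_def)
    then show ?thesis using B by (simp add: norm_sum_Pythagorean)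
  qed
  have "T v = (\<Sum>e\<in>B. (v \<bullet> e) *\<^sub>R T e)" by (subst v) (simp add: T.sum T.scaleR)
  also have "\<dots> = (\<Sum>e\<in>B. ((v \<bullet> e) * \<mu> e) *\<^sub>R e)" by (intro sum.cong) (simp_all add: eig)
  finally have "(norm (T v))\<^sup>2 = (\<Sum>e\<in>B. ((v \<bullet> e) * \<mu> e)\<^sup>2)" using parseval by simp
  also have "\<dots> \<le> (\<Sum>e\<in>B. m\<^sup>2 * (v \<bullet> e)\<^sup>2)"
  proof (rule sum_mono)
    fix e assume "e \<in> B"
    show "((v \<bullet> e) * \<mu> e)\<^sup>2 \<le> m\<^sup>2 * (v \<bullet> e)\<^sup>2"
    proof (cases "v \<bullet> e = 0")
      case False
      then have "(\<mu> e)\<^sup>2 \<le> m\<^sup>2" using bd[OF \<open>e \<in> B\<close>] m by (simp add: abs_le_square_iff[symmetric])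
      then show ?thesis by (simp add: power_mult_distrib mult_right_mono mult.commute[of "(v \<bullet> e)\<^sup>2"])
    qed simp
  qed
  also have "\<dots> = m\<^sup>2 * (norm v)\<^sup>2"
    using parseval[of "\<lambda>e. v \<bullet> e"] v by (simp add: sum_distrib_left)
  finally have "(norm (T v))\<^sup>2 \<le> (m * norm v)\<^sup>2" by (simp add: power_mult_distrib)
  then show ?thesis by (rule power2_le_imp_le) (use m in simp)
qed

section \<open>Singular values and the mean Kaczmarz step\<close>

lemma norm_matrix_vector_le_frobenius:
  fixes A :: "real ^ 'n ^ 'm"
  shows "norm (A *v x) \<le> frobenius_norm A * norm x"
proof -
  have "norm (A *v x) \<le> L2_set (\<lambda>i. norm (A $ i) * norm x) UNIV"
    unfolding norm_vec_def[of "A *v x"]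
    by (intro L2_set_mono) (simp_all add: matrix_vector_mul_component Cauchy_Schwarz_ineq2)
  also have "\<dots> = norm A * norm x"
    by (simp add: norm_vec_def[of A] L2_set_left_distrib)
  finally show ?thesis .
qed

lemma singular_value_le_frobenius:
  assumes "s \<in> singular_values A"
  shows "s\<^sup>2 \<le> (frobenius_norm A)\<^sup>2"
proof -
  obtain v where v: "v \<noteq> 0" "transpose A *v (A *v v) = s\<^sup>2 *\<^sub>R v"
    using assms by (auto simp: singular_values_def simp flip: matrix_vector_mul_assoc)
  have "s\<^sup>2 * (norm v)\<^sup>2 = (norm (A *v v))\<^sup>2"
    using inner_matrix_transpose[of A v "A *v v"] v(2)
    by (simp add: power2_norm_eq_inner del: transpose_matrix_vector)
  also have "\<dots> \<le> (frobenius_norm A * norm v)\<^sup>2"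
    by (intro power_mono norm_matrix_vector_le_frobenius) simp
  finally show ?thesis using v(1) by (simp add: power_mult_distrib)
qed

lemma linear_gram:
  fixes A :: "real ^ 'n ^ 'm"
  shows "linear (\<lambda>x. transpose A *v (A *v x))"
proof -
  have "linear ((\<lambda>y. transpose A *v y) \<circ> (\<lambda>x. A *v x))"
    by (rule linear_compose[OF matrix_vector_mul_linear matrix_vector_mul_linear])
  then show ?thesis by (simp only: o_def)
qed

text \<open>An eigenvalue of the Gram matrix at a unit vector \<open>e\<close> is the squared norm of \<open>A *v e\<close>, hence
  nonnegative and the square of a singular value. So the spectral theorem yields a basis of right
  singular vectors.\<close>

lemma gram_singular_basis:
  fixes A :: "real ^ 'n ^ 'm"
  shows "\<exists>B \<sigma>. finite B \<and> pairwise orthogonal B \<and> span B = UNIV \<and>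
    (\<forall>e\<in>B. norm e = 1 \<and> \<sigma> e \<in> singular_values A \<and> transpose A *v (A *v e) = (\<sigma> e)\<^sup>2 *\<^sub>R e)"
proof -
  define T where "T x = transpose A *v (A *v x)" for x
  have lin: "linear T"
    unfolding T_def by (rule linear_gram)
  have sa: "T x \<bullet> y = x \<bullet> T y" for x y
    unfolding T_def by (metis inner_commute inner_matrix_transpose)
  obtain B where B: "finite B" "pairwise orthogonal B" "span B = UNIV"
      "\<forall>e\<in>B. norm e = 1 \<and> (\<exists>c. T e = c *\<^sub>R e)"
    using self_adjoint_eigenbasis_of_subspace[OF lin sa subspace_UNIV] by blast
  have "\<exists>s. s \<in> singular_values A \<and> T e = s\<^sup>2 *\<^sub>R e" if e: "e \<in> B" for e
  proof -
    obtain c where c: "T e = c *\<^sub>R e" using B(4) e by blast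
    have ee: "e \<bullet> e = 1" using B(4) e by (simp add: norm_eq_1)
    have "c = T e \<bullet> e" using c ee by simp
    also have "\<dots> = (A *v e) \<bullet> (A *v e)" unfolding T_def by (metis inner_commute inner_matrix_transpose)
    finally have cn: "c = (A *v e) \<bullet> (A *v e)" .
    then have "c = (sqrt c)\<^sup>2" by simp
    moreover have "e \<noteq> 0" using ee by auto
    ultimately show ?thesis using c cn
      by (intro exI[of _ "sqrt c"])
         (auto simp: singular_values_def T_def simp flip: matrix_vector_mul_assoc)
  qed
  then obtain \<sigma> where "\<forall>e\<in>B. \<sigma> e \<in> singular_values A \<and> T e = (\<sigma> e)\<^sup>2 *\<^sub>R e" by metis
  then show ?thesis using B unfolding T_def by blast
qed

text \<open>One step of randomized Kaczmarz for the homogeneous system \<open>A *v x = 0\<close>, averaged over the row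
  drawn with probability proportional to its squared norm.\<close>

definition mean_step :: "real ^ 'n ^ 'm \<Rightarrow> real ^ 'n \<Rightarrow> real ^ 'n"
  where "mean_step A v = v - (1 / (frobenius_norm A)\<^sup>2) *\<^sub>R (transpose A *v (A *v v))"

lemma linear_mean_step: "linear (mean_step A)"
  unfolding mean_step_def[abs_def]
  by (intro linear_compose_sub linear_compose_scale_right linear_ident linear_gram)

lemma linear_mean_step_funpow: "linear (mean_step A ^^ k)"
proof (induction k)
  case (Suc k)
  show ?case unfolding funpow.simps by (rule linear_compose[OF Suc linear_mean_step])
next
  case 0
  show ?case unfolding funpow.simps by (rule linear_id)
qed

lemma mean_step_funpow_eigen:
  assumes "transpose A *v (A *v e) = c *\<^sub>R e"
  shows "(mean_step A ^^ k) e = (1 - c / (frobenius_norm A)\<^sup>2) ^ k *\<^sub>R e"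
proof (induction k)
  case (Suc k)
  interpret S: linear "mean_step A" by (rule linear_mean_step)
  have "mean_step A e = (1 - c / (frobenius_norm A)\<^sup>2) *\<^sub>R e"
    using assms by (simp add: mean_step_def algebra_simps)
  then show ?case by (simp add: Suc S.scaleR)
qed simp

lemma mean_step_funpow_null:
  assumes "v \<in> null_space A"
  shows "(mean_step A ^^ k) v = v"
proof -
  have "transpose A *v (A *v v) = 0 *\<^sub>R v" using assms by (simp add: null_space_def)
  from mean_step_funpow_eigen[OF this, of k] show ?thesis by simp
qed

text \<open>On the row space only nonzero singular values \<open>s\<close> occur. Each lies between \<open>sigma_min\<close> and
  \<open>sigma_max\<close>, and the multiplier \<open>q s = 1 - s\<^sup>2 / F\<close>, with \<open>F\<close> the squared Frobenius norm, lies in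
  \<open>[0, 1]\<close>. Powers of \<open>q s\<close> are therefore at most those of \<open>q sigma_min\<close> and at least those of
  \<open>q sigma_max\<close>; the two bounds are these two facts.\<close>

lemma mean_step_funpow_range_bounds:
  fixes A :: "real ^ 'n ^ 'm"
  assumes A: "A \<noteq> 0" and v: "v \<in> range_space (transpose A)"
  defines "\<alpha> \<equiv> 1 - (sigma_min A)\<^sup>2 / (frobenius_norm A)\<^sup>2"
    and "\<beta> \<equiv> \<lambda>k. 1 - (1 - (sigma_max A)\<^sup>2 / (frobenius_norm A)\<^sup>2) ^ k"
  shows mean_step_funpow_range_le: "norm ((mean_step A ^^ k) v) \<le> \<alpha> ^ k * norm v"
    and mean_step_funpow_range_diff_le: "norm (v - (mean_step A ^^ k) v) \<le> \<beta> k * norm v"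
proof -
  let ?F = "(frobenius_norm A)\<^sup>2"
  obtain B \<sigma> where B: "finite B" "pairwise orthogonal B" "span B = UNIV"
    "\<And>e. e \<in> B \<Longrightarrow> norm e = 1"
    and sv: "\<And>e. e \<in> B \<Longrightarrow> \<sigma> e \<in> singular_values A"
    and eig: "\<And>e. e \<in> B \<Longrightarrow> transpose A *v (A *v e) = (\<sigma> e)\<^sup>2 *\<^sub>R e"
    using gram_singular_basis[of A] by blast
  define q where "q s = 1 - s\<^sup>2 / ?F" for s
  have F: "?F > 0" using A by simp
  have q0: "0 \<le> q s" and q1: "q s \<le> 1" if "s \<in> singular_values A" for s
    using singular_value_le_frobenius[OF that] F by (simp_all add: q_def)
  have ge0: "s \<ge> 0" if "s \<in> singular_values A" for s using that by (simp add: singular_values_def)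
  note fin = finite_singular_values[of A]
  have mn: "sigma_min A \<in> singular_values A - {0}"
    unfolding sigma_min_def using fin nonzero_singular_values_nonempty[OF A] by (intro Min_in) auto
  have mx: "sigma_max A \<in> singular_values A"
    unfolding sigma_max_def using fin mn by (intro Max_in) auto
  have nz: "\<sigma> e \<noteq> 0" if e: "e \<in> B" "v \<bullet> e \<noteq> 0" for e
  proof
    assume "\<sigma> e = 0"
    then have "(A *v e) \<bullet> (A *v e) = 0" using eig[OF e(1)]
      by (simp add: inner_matrix_transpose del: transpose_matrix_vector)
    then have "A *v e = 0" by simp
    moreover obtain w where "v = transpose A *v w" using v by (auto simp: range_space_def)
    ultimately have "v \<bullet> e = 0" using inner_matrix_transpose[of A e w] by (simp add: inner_commute)
    then show False using e by simp
  qed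
  have le: "q (\<sigma> e) \<le> q (sigma_min A)" if e: "e \<in> B" "v \<bullet> e \<noteq> 0" for e
  proof -
    have "sigma_min A \<le> \<sigma> e"
      unfolding sigma_min_def using fin sv[OF e(1)] nz[OF e] by (intro Min_le) auto
    then have "(sigma_min A)\<^sup>2 \<le> (\<sigma> e)\<^sup>2" using mn ge0 by (intro power_mono) auto
    then show ?thesis using F by (simp add: q_def divide_right_mono)
  qed
  have ge: "q (sigma_max A) \<le> q (\<sigma> e)" if e: "e \<in> B" for e
  proof -
    have "\<sigma> e \<le> sigma_max A"
      unfolding sigma_max_def using fin sv[OF e(1)] by (intro Max_ge) auto
    then have "(\<sigma> e)\<^sup>2 \<le> (sigma_max A)\<^sup>2" using sv[OF e] ge0 by (intro power_mono) auto
    then show ?thesis using F by (simp add: q_def divide_right_mono)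
  qed
  have pow: "(mean_step A ^^ k) e = q (\<sigma> e) ^ k *\<^sub>R e" if "e \<in> B" for e
    unfolding q_def by (rule mean_step_funpow_eigen[OF eig[OF that]])
  have al: "\<alpha> = q (sigma_min A)" and be: "\<beta> k = 1 - q (sigma_max A) ^ k"
    by (simp_all add: \<alpha>_def \<beta>_def q_def)
  show "norm ((mean_step A ^^ k) v) \<le> \<alpha> ^ k * norm v"
  proof (rule norm_le_of_orthonormal_eigenbasis[OF linear_mean_step_funpow B(1,2,4) _ pow])
    show "\<bar>q (\<sigma> e) ^ k\<bar> \<le> \<alpha> ^ k" if "e \<in> B" "v \<bullet> e \<noteq> 0" for e
      unfolding al using le[OF that] q0[OF sv[OF that(1)]] by (simp add: power_mono)
    show "0 \<le> \<alpha> ^ k" unfolding al using q0 mn by simp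
  qed (simp_all add: B(3))
  show "norm (v - (mean_step A ^^ k) v) \<le> \<beta> k * norm v"
  proof (rule norm_le_of_orthonormal_eigenbasis[where T = "\<lambda>v. v - (mean_step A ^^ k) v", OF _ B(1,2,4)])
    show "linear (\<lambda>v. v - (mean_step A ^^ k) v)"
      by (intro linear_compose_sub linear_ident linear_mean_step_funpow)
    show "e - (mean_step A ^^ k) e = (1 - q (\<sigma> e) ^ k) *\<^sub>R e" if "e \<in> B" for e
      using pow[OF that] by (simp add: algebra_simps)
    show "\<bar>1 - q (\<sigma> e) ^ k\<bar> \<le> \<beta> k" if "e \<in> B" "v \<bullet> e \<noteq> 0" for e
      unfolding be using power_mono[OF ge[OF that(1)] q0[OF mx], of k]
        power_le_one[OF q0 q1, OF sv sv, OF that(1) that(1), of k] by simp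
    show "0 \<le> \<beta> k" unfolding be using power_le_one[OF q0[OF mx] q1[OF mx], of k] by simp
  qed (simp_all add: B(3))
qed

section \<open>Orthogonal projections and the normal equation\<close>

lemma
  assumes "subspace V"
  shows orth_proj_in: "orth_proj V x \<in> V"
    and orth_proj_orthogonal: "v \<in> V \<Longrightarrow> orthogonal (x - orth_proj V x) v"
  using theI'[OF orth_proj_ex1[OF assms], of x] unfolding orth_proj_def[symmetric] by (blast, blast)

lemma diff_orth_proj_range_in_null_space:
  "x - orth_proj (range_space (transpose A)) x \<in> null_space A"
proof -
  let ?y = "x - orth_proj (range_space (transpose A)) x"
  have "(A *v ?y) \<bullet> w = 0" for w
    using orth_proj_orthogonal[OF subspace_range_space, of "transpose A *v w" "transpose A" x]
    by (auto simp: inner_matrix_transpose orthogonal_def range_space_def)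
  then show ?thesis using inner_eq_zero_iff unfolding null_space_def by blast
qed

lemma orth_proj_null_space:
  "orth_proj (null_space A) x = x - orth_proj (range_space (transpose A)) x"
proof -
  let ?p = "orth_proj (range_space (transpose A)) x"
  obtain w where w: "?p = transpose A *v w"
    using orth_proj_in[OF subspace_range_space, of "transpose A" x] unfolding range_space_def by blast
  have "orthogonal (x - (x - ?p)) v" if "v \<in> null_space A" for v
    using that w inner_matrix_transpose[of A v w]
    by (simp add: orthogonal_def null_space_def inner_commute)
  moreover have "x - ?p \<in> null_space A" by (rule diff_orth_proj_range_in_null_space)
  ultimately show ?thesis
    unfolding orth_proj_def[of "null_space A"]
    by (intro the1_equality[OF orth_proj_ex1[OF subspace_null_space]]) blast
qed

text \<open>As \<open>A ** pinv A\<close> is symmetric, this is the transpose of the Penrose equation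
  \<open>A ** pinv A ** A = A\<close>, applied to \<open>b\<close>.\<close>

lemma pinv_normal_equation:
  "transpose A *v (A *v (pinv A *v b)) = transpose A *v b"
proof -
  have "transpose A ** (A ** pinv A) = transpose A ** transpose (A ** pinv A)"
    using is_pinv_pinv[of A] by (simp add: is_pinv_def)
  also have "\<dots> = transpose (A ** pinv A ** A)" by (simp add: matrix_transpose_mul)
  also have "\<dots> = transpose A" using is_pinv_pinv[of A] by (simp add: is_pinv_def)
  finally show ?thesis by (simp add: matrix_vector_mul_assoc del: transpose_matrix_vector)
qed

section \<open>Averaging over a draw that is independent of the past\<close>

lemma rek_z_cong:
  assumes "\<And>l. l \<in> {1..k} \<Longrightarrow> j l = j' l"
  shows "rek_z A b j k = rek_z A b j' k"
  using assms
proof (induction k)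
  case (Suc k)
  have "rek_z A b j k = rek_z A b j' k" by (rule Suc.IH) (use Suc.prems in auto)
  moreover have "j (Suc k) = j' (Suc k)" by (rule Suc.prems) simp
  ultimately show ?case by (simp only: rek_z.simps)
qed (simp only: rek_z.simps)

lemma rek_x_cong:
  assumes "\<And>l. l \<in> {1..k} \<Longrightarrow> j l = j' l" "\<And>l. l \<in> {1..k} \<Longrightarrow> i l = i' l"
  shows "rek_x A b x0 j i k = rek_x A b x0 j' i' k"
  using assms
proof (induction k)
  case (Suc k)
  have "rek_z A b j k = rek_z A b j' k" by (rule rek_z_cong) (use Suc.prems in auto)
  moreover have "rek_x A b x0 j i k = rek_x A b x0 j' i' k" by (rule Suc.IH) (use Suc.prems in auto)
  moreover have "i (Suc k) = i' (Suc k)" by (rule Suc.prems) simp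
  ultimately show ?case by (simp only: rek_x.simps)
qed (simp only: rek_x.simps)

text \<open>A draw outside the finite set \<open>P\<close> may be averaged out separately: it is independent of the
  joint history \<open>H\<close> of the draws in \<open>P\<close>. The draws take values in a finite type, so \<open>H\<close> has finitely
  many values and every function of it is measurable and bounded. Factoring the
  expectation of a product needs scalars, so the claim is first proved for real functions of \<open>H\<close> and then
  transferred to vectors coordinatewise.\<close>

lemma (in prob_space) expectation_of_fresh_draw:
  fixes D :: "'t \<Rightarrow> 'a \<Rightarrow> 'c::finite" and f :: "'c \<Rightarrow> ('t \<Rightarrow> 'c) \<Rightarrow> 'v::euclidean_space"
  assumes ind: "indep_vars (\<lambda>_. count_space UNIV) D T"
    and P: "finite P" "P \<subseteq> T" and t: "t \<in> T" "t \<notin> P"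
  defines "H \<equiv> \<lambda>\<omega>. restrict (\<lambda>s. D s \<omega>) P"
  shows integrable_of_draws: "integrable M (\<lambda>\<omega>. g (H \<omega>) :: 'v)"
    and expectation_fresh_draw: "(\<integral>\<omega>. f (D t \<omega>) (H \<omega>) \<partial>M) =
      (\<Sum>c\<in>UNIV. prob {\<omega> \<in> space M. D t \<omega> = c} *\<^sub>R (\<integral>\<omega>. f c (H \<omega>) \<partial>M))"
proof -
  let ?E = "PiE P (\<lambda>_. UNIV :: 'c set)"
  have PiM: "PiM P (\<lambda>_. count_space (UNIV :: 'c set)) = count_space ?E"
    using P(1) by (intro count_space_PiM_finite) auto
  have D[measurable]: "D s \<in> measurable M (count_space UNIV)" if "s \<in> T" for s
    using ind that by (simp add: indep_vars_def)
  have "H \<in> measurable M (PiM P (\<lambda>_. count_space UNIV))"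
    unfolding H_def using P by (intro measurable_restrict D) auto
  then have H: "H \<in> measurable M (count_space ?E)" by (simp add: PiM)
  have finE: "finite ?E" using P(1) by (intro finite_PiE) auto
  have int: "integrable M (\<lambda>\<omega>. h (H \<omega>))"
    for h :: "('t \<Rightarrow> 'c) \<Rightarrow> 'w::euclidean_space"
  proof (rule integrable_const_bound)
    show "(\<lambda>\<omega>. h (H \<omega>)) \<in> borel_measurable M"
      by (rule measurable_compose[OF H]) simp
    show "AE \<omega> in M. norm (h (H \<omega>)) \<le> Max (norm ` h ` ?E)"
      using finE H by (intro AE_I2 Max_ge) (auto simp: H_def)
  qed
  show "integrable M (\<lambda>\<omega>. g (H \<omega>) :: 'v)" by (rule int)
  define K where "K c \<omega> = (if D t \<omega> = c then 1 else 0 :: real)" for c \<omega>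
  have K_meas: "K c \<in> borel_measurable M" for c
    unfolding K_def by (rule measurable_compose[OF D[OF t(1)]]) simp
  have K_int: "integrable M (K c)" for c
    by (rule integrable_const_bound[of _ 1]) (auto simp: K_meas, simp add: K_def)
  have EK: "(\<integral>\<omega>. K c \<omega> \<partial>M) = prob {\<omega> \<in> space M. D t \<omega> = c}" for c
  proof -
    have "(\<integral>\<omega>. K c \<omega> \<partial>M) = (\<integral>\<omega>. indicator {\<omega> \<in> space M. D t \<omega> = c} \<omega> \<partial>M)"
      by (intro Bochner_Integration.integral_cong) (auto simp: K_def)
    also have "\<dots> = prob {\<omega> \<in> space M. D t \<omega> = c}"
      by (simp add: Int_absorb2 subset_eq)
    finally show ?thesis .
  qed
  have scalar: "integrable M (\<lambda>\<omega>. K c \<omega> * h (H \<omega>))"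
    "(\<integral>\<omega>. K c \<omega> * h (H \<omega>) \<partial>M) = prob {\<omega> \<in> space M. D t \<omega> = c} * (\<integral>\<omega>. h (H \<omega>) \<partial>M)"
    for c and h :: "('t \<Rightarrow> 'c) \<Rightarrow> real"
  proof -
    have "indep_var (PiM {t} (\<lambda>_. count_space UNIV)) (\<lambda>\<omega>. restrict (\<lambda>s. D s \<omega>) {t})
       (PiM P (\<lambda>_. count_space UNIV)) (\<lambda>\<omega>. restrict (\<lambda>s. D s \<omega>) P)"
      using P t by (intro indep_var_restrict[OF ind]) auto
    then have "indep_var borel ((\<lambda>r. if r t = c then 1 else 0 :: real) \<circ> (\<lambda>\<omega>. restrict (\<lambda>s. D s \<omega>) {t}))
       borel (h \<circ> (\<lambda>\<omega>. restrict (\<lambda>s. D s \<omega>) P))"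
    proof (rule indep_var_compose)
      show "(\<lambda>r. if r t = c then 1 else 0 :: real) \<in> PiM {t} (\<lambda>_. count_space UNIV) \<rightarrow>\<^sub>M borel"
        by (rule measurable_compose[OF measurable_component_singleton]) simp_all
      show "h \<in> PiM P (\<lambda>_. count_space UNIV) \<rightarrow>\<^sub>M borel" unfolding PiM by simp
    qed
    then have iv: "indep_var borel (K c) borel (\<lambda>\<omega>. h (H \<omega>))"
      by (simp add: o_def K_def[abs_def] H_def)
    show "integrable M (\<lambda>\<omega>. K c \<omega> * h (H \<omega>))"
      by (rule indep_var_integrable[OF iv K_int int])
    show "(\<integral>\<omega>. K c \<omega> * h (H \<omega>) \<partial>M) = prob {\<omega> \<in> space M. D t \<omega> = c} * (\<integral>\<omega>. h (H \<omega>) \<partial>M)"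
      using indep_var_lebesgue_integral[OF iv K_int int] by (simp add: EK)
  qed
  have int_c: "integrable M (\<lambda>\<omega>. K c \<omega> *\<^sub>R f c (H \<omega>))" for c
  proof (rule Bochner_Integration.integrable_bound)
    show "integrable M (\<lambda>\<omega>. norm (f c (H \<omega>)))" by (intro integrable_norm int)
    show "(\<lambda>\<omega>. K c \<omega> *\<^sub>R f c (H \<omega>)) \<in> borel_measurable M"
      by (intro borel_measurable_scaleR K_meas measurable_compose[OF H]) simp
  qed (auto simp: K_def)
  have "(\<integral>\<omega>. f (D t \<omega>) (H \<omega>) \<partial>M) = (\<integral>\<omega>. (\<Sum>c\<in>UNIV. K c \<omega> *\<^sub>R f c (H \<omega>)) \<partial>M)"
    by (simp add: K_def if_distribR if_distrib[of "\<lambda>r. r *\<^sub>R _"] cong: if_cong)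
  also have "\<dots> = (\<Sum>c\<in>UNIV. (\<integral>\<omega>. K c \<omega> *\<^sub>R f c (H \<omega>) \<partial>M))"
    by (intro Bochner_Integration.integral_sum int_c)
  also have "\<dots> = (\<Sum>c\<in>UNIV. prob {\<omega> \<in> space M. D t \<omega> = c} *\<^sub>R (\<integral>\<omega>. f c (H \<omega>) \<partial>M))"
  proof (intro sum.cong refl)
    fix c
    show "(\<integral>\<omega>. K c \<omega> *\<^sub>R f c (H \<omega>) \<partial>M) =
      prob {\<omega> \<in> space M. D t \<omega> = c} *\<^sub>R (\<integral>\<omega>. f c (H \<omega>) \<partial>M)"
    proof (rule euclidean_eqI)
      fix u :: 'v assume "u \<in> Basis"
      have "(\<integral>\<omega>. K c \<omega> *\<^sub>R f c (H \<omega>) \<partial>M) \<bullet> u = (\<integral>\<omega>. K c \<omega> * (f c (H \<omega>) \<bullet> u) \<partial>M)"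
        using integral_inner_left[where c = u, OF int_c[of c]] by simp
      also have "\<dots> = prob {\<omega> \<in> space M. D t \<omega> = c} * (\<integral>\<omega>. f c (H \<omega>) \<bullet> u \<partial>M)"
        by (rule scalar(2))
      also have "\<dots> = (prob {\<omega> \<in> space M. D t \<omega> = c} *\<^sub>R (\<integral>\<omega>. f c (H \<omega>) \<partial>M)) \<bullet> u"
        by (simp add: integral_inner_left[OF int])
      finally show "(\<integral>\<omega>. K c \<omega> *\<^sub>R f c (H \<omega>) \<partial>M) \<bullet> u =
        (prob {\<omega> \<in> space M. D t \<omega> = c} *\<^sub>R (\<integral>\<omega>. f c (H \<omega>) \<partial>M)) \<bullet> u" .
    qed
  qed
  finally show "(\<integral>\<omega>. f (D t \<omega>) (H \<omega>) \<partial>M) =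
      (\<Sum>c\<in>UNIV. prob {\<omega> \<in> space M. D t \<omega> = c} *\<^sub>R (\<integral>\<omega>. f c (H \<omega>) \<partial>M))" .
qed

section \<open>Expected iterates of the randomized extended Kaczmarz method\<close>

lemma sum_norm_row:
  fixes A :: "real ^ 'n ^ 'm"
  shows "(\<Sum>i\<in>UNIV. (norm (row i A))\<^sup>2) = (frobenius_norm A)\<^sup>2"
  by (simp add: norm_vec_def[of A] L2_set_def sum_nonneg row_def)

lemma sum_norm_column:
  fixes A :: "real ^ 'n ^ 'm"
  shows "(\<Sum>j\<in>UNIV. (norm (column j A))\<^sup>2) = (frobenius_norm A)\<^sup>2"
proof -
  have "(\<Sum>j\<in>UNIV. (norm (column j A))\<^sup>2) = (\<Sum>j\<in>UNIV. \<Sum>i\<in>UNIV. (A $ i $ j)\<^sup>2)"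
    by (simp add: norm_vec_def L2_set_def sum_nonneg column_def)
  also have "\<dots> = (\<Sum>i\<in>UNIV. \<Sum>j\<in>UNIV. (A $ i $ j)\<^sup>2)" by (rule sum.swap)
  also have "\<dots> = (frobenius_norm A)\<^sup>2" by (simp add: frobenius_norm_eq sum_nonneg)
  finally show ?thesis .
qed

lemma sum_scaleR_row:
  fixes A :: "real ^ 'n ^ 'm"
  shows "(\<Sum>i\<in>UNIV. (y $ i) *\<^sub>R row i A) = transpose A *v y"
  by (simp add: matrix_mult_sum scalar_mult_eq_scaleR del: transpose_matrix_vector)

lemma sum_scaleR_column:
  fixes A :: "real ^ 'n ^ 'm"
  shows "(\<Sum>j\<in>UNIV. (x $ j) *\<^sub>R column j A) = A *v x"
  by (simp add: matrix_mult_sum scalar_mult_eq_scaleR)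

context rek_draws
begin

definition draw :: "nat + nat \<Rightarrow> 'w \<Rightarrow> 'n + 'm"
  where "draw s \<omega> = (case s of Inl k \<Rightarrow> Inl (J k \<omega>) | Inr k \<Rightarrow> Inr (I k \<omega>))"

text \<open>The draws of the steps \<open>1, \<dots>, k\<close>, which determine both iterates of index \<open>k\<close>.\<close>

definition past :: "nat \<Rightarrow> 'w \<Rightarrow> nat + nat \<Rightarrow> 'n + 'm"
  where "past k \<omega> = restrict (\<lambda>s. draw s \<omega>) (Inl ` {1..k} \<union> Inr ` {1..k})"

lemma indep_vars_draw:
  "indep_vars (\<lambda>_. count_space UNIV) draw (Inl ` {1..} \<union> Inr ` {1..})"
  using indep_draws unfolding draw_def[abs_def] .

lemma integrable_past:
  fixes g :: "_ \<Rightarrow> 'v::euclidean_space"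
  shows "integrable M (\<lambda>\<omega>. g (past k \<omega>))"
  unfolding past_def
  by (rule integrable_of_draws[OF indep_vars_draw, where t = "Inl (Suc k)"]) auto

lemma expectation_next_column:
  fixes f :: "'n \<Rightarrow> _ \<Rightarrow> 'v::euclidean_space"
  shows "(\<integral>\<omega>. f (J (Suc k) \<omega>) (past k \<omega>) \<partial>M) =
    (\<Sum>j\<in>UNIV. ((norm (column j A))\<^sup>2 / (frobenius_norm A)\<^sup>2) *\<^sub>R (\<integral>\<omega>. f j (past k \<omega>) \<partial>M))"
proof -
  let ?g = "\<lambda>c h. case c of Inl j \<Rightarrow> f j h | Inr i \<Rightarrow> 0"
  have "(\<integral>\<omega>. ?g (draw (Inl (Suc k)) \<omega>) (past k \<omega>) \<partial>M) =
    (\<Sum>c\<in>UNIV. prob {\<omega> \<in> space M. draw (Inl (Suc k)) \<omega> = c} *\<^sub>R (\<integral>\<omega>. ?g c (past k \<omega>) \<partial>M))"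
    unfolding past_def
    by (rule expectation_fresh_draw[OF indep_vars_draw]) auto
  also have "\<dots> = (\<Sum>j\<in>UNIV. ((norm (column j A))\<^sup>2 / (frobenius_norm A)\<^sup>2) *\<^sub>R (\<integral>\<omega>. f j (past k \<omega>) \<partial>M))"
    by (simp add: UNIV_Plus_UNIV[symmetric] sum.Plus draw_def prob_column del: UNIV_Plus_UNIV)
  finally show ?thesis by (simp add: draw_def)
qed

lemma expectation_next_row:
  fixes f :: "'m \<Rightarrow> _ \<Rightarrow> 'v::euclidean_space"
  shows "(\<integral>\<omega>. f (I (Suc k) \<omega>) (past k \<omega>) \<partial>M) =
    (\<Sum>i\<in>UNIV. ((norm (row i A))\<^sup>2 / (frobenius_norm A)\<^sup>2) *\<^sub>R (\<integral>\<omega>. f i (past k \<omega>) \<partial>M))"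
proof -
  let ?g = "\<lambda>c h. case c of Inl j \<Rightarrow> 0 | Inr i \<Rightarrow> f i h"
  have "(\<integral>\<omega>. ?g (draw (Inr (Suc k)) \<omega>) (past k \<omega>) \<partial>M) =
    (\<Sum>c\<in>UNIV. prob {\<omega> \<in> space M. draw (Inr (Suc k)) \<omega> = c} *\<^sub>R (\<integral>\<omega>. ?g c (past k \<omega>) \<partial>M))"
    unfolding past_def
    by (rule expectation_fresh_draw[OF indep_vars_draw]) auto
  also have "\<dots> = (\<Sum>i\<in>UNIV. ((norm (row i A))\<^sup>2 / (frobenius_norm A)\<^sup>2) *\<^sub>R (\<integral>\<omega>. f i (past k \<omega>) \<partial>M))"
    by (simp add: UNIV_Plus_UNIV[symmetric] sum.Plus draw_def prob_row del: UNIV_Plus_UNIV)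
  finally show ?thesis by (simp add: draw_def)
qed

definition Z :: "real ^ 'm \<Rightarrow> nat \<Rightarrow> 'w \<Rightarrow> real ^ 'm"
  where "Z b k \<omega> = rek_z A b (\<lambda>l. J l \<omega>) k"

definition X :: "real ^ 'm \<Rightarrow> real ^ 'n \<Rightarrow> nat \<Rightarrow> 'w \<Rightarrow> real ^ 'n"
  where "X b x0 k \<omega> = rek_x A b x0 (\<lambda>l. J l \<omega>) (\<lambda>l. I l \<omega>) k"

lemma Z_past: "\<exists>\<zeta>. Z b k = (\<lambda>\<omega>. \<zeta> (past k \<omega>))"
proof
  show "Z b k = (\<lambda>\<omega>. rek_z A b (\<lambda>l. projl (past k \<omega> (Inl l))) k)"
    unfolding Z_def by (intro ext rek_z_cong) (simp add: past_def draw_def)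
qed

lemma X_past: "\<exists>\<xi>. X b x0 k = (\<lambda>\<omega>. \<xi> (past k \<omega>))"
proof
  show "X b x0 k = (\<lambda>\<omega>. rek_x A b x0 (\<lambda>l. projl (past k \<omega> (Inl l))) (\<lambda>l. projr (past k \<omega> (Inr l))) k)"
    unfolding X_def by (intro ext rek_x_cong) (simp_all add: past_def draw_def)
qed

lemma integrable_Z: "integrable M (Z b k)"
proof -
  obtain \<zeta> where "Z b k = (\<lambda>\<omega>. \<zeta> (past k \<omega>))" using Z_past by metis
  then show ?thesis by (simp add: integrable_past)
qed

lemma integrable_X: "integrable M (X b x0 k)"
proof -
  obtain \<xi> where "X b x0 k = (\<lambda>\<omega>. \<xi> (past k \<omega>))" using X_past by metis
  then show ?thesis by (simp add: integrable_past)
qed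

text \<open>Drawing a column with probability proportional to its squared norm cancels the normalisation of
  the projection, so the averaged correction is \<open>A *v (transpose A *v z)\<close> up to the Frobenius
  factor. A zero column contributes nothing to either side.\<close>

lemma expectation_Z_Suc:
  assumes "A \<noteq> 0"
  shows "(\<integral>\<omega>. Z b (Suc k) \<omega> \<partial>M) = (\<integral>\<omega>. Z b k \<omega> \<partial>M)
    - (1 / (frobenius_norm A)\<^sup>2) *\<^sub>R (A *v (transpose A *v (\<integral>\<omega>. Z b k \<omega> \<partial>M)))"
proof -
  obtain \<zeta> where \<zeta>: "Z b k = (\<lambda>\<omega>. \<zeta> (past k \<omega>))" using Z_past by metis
  let ?F = "(frobenius_norm A)\<^sup>2" and ?c = "\<lambda>j. column j A" and ?EZ = "\<integral>\<omega>. Z b k \<omega> \<partial>M"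
  note int = integrable_Z[of b k, unfolded \<zeta>]
  define g where "g j h = \<zeta> h - ((?c j \<bullet> \<zeta> h) / (norm (?c j))\<^sup>2) *\<^sub>R ?c j" for j h
  have Eg: "(\<integral>\<omega>. g j (past k \<omega>) \<partial>M) = ?EZ - ((?c j \<bullet> ?EZ) / (norm (?c j))\<^sup>2) *\<^sub>R ?c j" for j
    unfolding g_def \<zeta> using int by simp
  have "(\<integral>\<omega>. Z b (Suc k) \<omega> \<partial>M) = (\<integral>\<omega>. g (J (Suc k) \<omega>) (past k \<omega>) \<partial>M)"
    using fun_cong[OF \<zeta>] by (simp add: g_def Z_def Let_def)
  also have "\<dots> = (\<Sum>j\<in>UNIV. ((norm (?c j))\<^sup>2 / ?F) *\<^sub>R (?EZ - ((?c j \<bullet> ?EZ) / (norm (?c j))\<^sup>2) *\<^sub>R ?c j))"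
    unfolding expectation_next_column Eg ..
  also have "\<dots> = (\<Sum>j\<in>UNIV. ((norm (?c j))\<^sup>2 / ?F) *\<^sub>R ?EZ - (1 / ?F) *\<^sub>R ((transpose A *v ?EZ) $ j) *\<^sub>R ?c j)"
  proof (intro sum.cong refl)
    fix j
    have "(transpose A *v ?EZ) $ j = ?c j \<bullet> ?EZ"
      by (simp add: matrix_vector_mult_def column_def transpose_def inner_vec_def del: transpose_matrix_vector)
    then show "((norm (?c j))\<^sup>2 / ?F) *\<^sub>R (?EZ - ((?c j \<bullet> ?EZ) / (norm (?c j))\<^sup>2) *\<^sub>R ?c j)
      = ((norm (?c j))\<^sup>2 / ?F) *\<^sub>R ?EZ - (1 / ?F) *\<^sub>R ((transpose A *v ?EZ) $ j) *\<^sub>R ?c j"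
      by (cases "?c j = 0") (simp_all add: scaleR_diff_right del: transpose_matrix_vector)
  qed
  also have "\<dots> = (1 / ?F) *\<^sub>R (\<Sum>j\<in>UNIV. (norm (?c j))\<^sup>2) *\<^sub>R ?EZ
      - (1 / ?F) *\<^sub>R (\<Sum>j\<in>UNIV. ((transpose A *v ?EZ) $ j) *\<^sub>R ?c j)"
    by (simp add: sum_subtractf scaleR_sum_right scaleR_sum_left sum_divide_distrib del: transpose_matrix_vector)
  finally show ?thesis
    using assms unfolding sum_norm_column sum_scaleR_column by simp
qed

text \<open>The same cancellation for rows. Row and column of a step are drawn independently of the past, and
  the row update uses the old \<open>Z b k\<close>. For a fixed row the update is affine in the two iterates, so
  only their expectations enter, however they depend on each other.\<close>

lemma expectation_X_Suc:
  assumes "A \<noteq> 0"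
  shows "(\<integral>\<omega>. X b x0 (Suc k) \<omega> \<partial>M) = (\<integral>\<omega>. X b x0 k \<omega> \<partial>M)
    - (1 / (frobenius_norm A)\<^sup>2) *\<^sub>R
        (transpose A *v (A *v (\<integral>\<omega>. X b x0 k \<omega> \<partial>M) - b + (\<integral>\<omega>. Z b k \<omega> \<partial>M)))"
proof -
  obtain \<zeta> where \<zeta>: "Z b k = (\<lambda>\<omega>. \<zeta> (past k \<omega>))" using Z_past by metis
  obtain \<xi> where \<xi>: "X b x0 k = (\<lambda>\<omega>. \<xi> (past k \<omega>))" using X_past by metis
  let ?F = "(frobenius_norm A)\<^sup>2" and ?r = "\<lambda>i. row i A"
    and ?EZ = "\<integral>\<omega>. Z b k \<omega> \<partial>M" and ?EX = "\<integral>\<omega>. X b x0 k \<omega> \<partial>M"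
  let ?y = "A *v ?EX - b + ?EZ"
  note int = integrable_Z[of b k, unfolded \<zeta>] integrable_X[of b x0 k, unfolded \<xi>]
  \<comment> \<open>The entry of \<open>\<zeta> h\<close> is written as an inner product so that linearity of the integral applies.\<close>
  define g where "g i h = \<xi> h - ((?r i \<bullet> \<xi> h - b $ i + \<zeta> h \<bullet> axis i 1) / (norm (?r i))\<^sup>2) *\<^sub>R ?r i" for i h
  have Eg: "(\<integral>\<omega>. g i (past k \<omega>) \<partial>M) =
      ?EX - ((?r i \<bullet> ?EX - b $ i + ?EZ \<bullet> axis i 1) / (norm (?r i))\<^sup>2) *\<^sub>R ?r i" for i
    unfolding g_def \<zeta> \<xi> using int by (simp add: prob_space)
  have "(\<integral>\<omega>. X b x0 (Suc k) \<omega> \<partial>M) = (\<integral>\<omega>. g (I (Suc k) \<omega>) (past k \<omega>) \<partial>M)"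
    using fun_cong[OF \<zeta>] fun_cong[OF \<xi>] by (simp add: g_def X_def Z_def Let_def inner_axis)
  also have "\<dots> = (\<Sum>i\<in>UNIV. ((norm (?r i))\<^sup>2 / ?F) *\<^sub>R
      (?EX - ((?r i \<bullet> ?EX - b $ i + ?EZ \<bullet> axis i 1) / (norm (?r i))\<^sup>2) *\<^sub>R ?r i))"
    unfolding expectation_next_row Eg ..
  also have "\<dots> = (\<Sum>i\<in>UNIV. ((norm (?r i))\<^sup>2 / ?F) *\<^sub>R ?EX - (1 / ?F) *\<^sub>R (?y $ i) *\<^sub>R ?r i)"
  proof (intro sum.cong refl)
    fix i
    have "?y $ i = ?r i \<bullet> ?EX - b $ i + ?EZ \<bullet> axis i 1"
      by (simp add: matrix_vector_mul_component row_def inner_axis)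
    then show "((norm (?r i))\<^sup>2 / ?F) *\<^sub>R
        (?EX - ((?r i \<bullet> ?EX - b $ i + ?EZ \<bullet> axis i 1) / (norm (?r i))\<^sup>2) *\<^sub>R ?r i)
      = ((norm (?r i))\<^sup>2 / ?F) *\<^sub>R ?EX - (1 / ?F) *\<^sub>R (?y $ i) *\<^sub>R ?r i"
      by (cases "?r i = 0") (simp_all only: scaleR_diff_right, simp_all)
  qed
  also have "\<dots> = (1 / ?F) *\<^sub>R (\<Sum>i\<in>UNIV. (norm (?r i))\<^sup>2) *\<^sub>R ?EX - (1 / ?F) *\<^sub>R (\<Sum>i\<in>UNIV. (?y $ i) *\<^sub>R ?r i)"
    by (simp only: sum_subtractf scaleR_sum_right scaleR_sum_left) (simp add: sum_divide_distrib)
  finally show ?thesis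
    using assms unfolding sum_norm_row sum_scaleR_row by simp
qed

text \<open>Each step applies \<open>I - A A\<^sup>T / F\<close> to the mean of \<open>Z\<close>, where \<open>F\<close> is the squared Frobenius norm,
  and \<open>A\<^sup>T (I - A A\<^sup>T / F) = (I - A\<^sup>T A / F) A\<^sup>T\<close>.\<close>

lemma transpose_expectation_Z:
  assumes "A \<noteq> 0"
  shows "transpose A *v (\<integral>\<omega>. Z b k \<omega> \<partial>M) = (mean_step A ^^ k) (transpose A *v b)"
proof (induction k)
  case 0
  show ?case by (simp add: Z_def prob_space)
next
  case (Suc k)
  have "transpose A *v (\<integral>\<omega>. Z b (Suc k) \<omega> \<partial>M) = mean_step A (transpose A *v (\<integral>\<omega>. Z b k \<omega> \<partial>M))"
    unfolding expectation_Z_Suc[OF assms] mean_step_def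
    by (simp only: matrix_vector_mult_diff_distrib matrix_vector_mult_scaleR)
  then show ?case unfolding Suc by simp
qed

text \<open>By the normal equation the mean error obeys \<open>e' = S e - u / F\<close>, where \<open>S\<close> is the mean step, \<open>F\<close>
  the squared Frobenius norm and \<open>u = (S ^^ k) (transpose A *v b)\<close>. The forcing term \<open>u\<close> evolves
  under the same map \<open>S\<close> as the error, so each of the first \<open>k\<close> steps contributes the same vector;
  this is the origin of the factor \<open>k\<close>. For \<open>k = 0\<close> that factor kills the term in which \<open>k - 1\<close> is
  truncated.\<close>

lemma expectation_X:
  assumes A: "A \<noteq> 0"
  shows "(\<integral>\<omega>. X b x0 k \<omega> \<partial>M) - pinv A *v b = (mean_step A ^^ k) (x0 - pinv A *v b)
    - (real k / (frobenius_norm A)\<^sup>2) *\<^sub>R (mean_step A ^^ (k - 1)) (transpose A *v b)"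
proof (induction k)
  case 0
  show ?case by (simp add: X_def prob_space)
next
  case (Suc k)
  interpret S: linear "mean_step A" by (rule linear_mean_step)
  let ?S = "mean_step A" and ?F = "(frobenius_norm A)\<^sup>2" and ?y = "pinv A *v b"
    and ?u = "transpose A *v b" and ?EX = "\<integral>\<omega>. X b x0 k \<omega> \<partial>M" and ?EZ = "\<integral>\<omega>. Z b k \<omega> \<partial>M"
  have "transpose A *v (A *v ?EX - b + ?EZ) = transpose A *v (A *v (?EX - ?y)) + transpose A *v ?EZ"
    unfolding matrix_vector_right_distrib matrix_vector_mult_diff_distrib pinv_normal_equation ..
  then have "(\<integral>\<omega>. X b x0 (Suc k) \<omega> \<partial>M) - ?y = ?S (?EX - ?y) - (1 / ?F) *\<^sub>R (?S ^^ k) ?u"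
    unfolding expectation_X_Suc[OF A] mean_step_def[of A "?EX - ?y"] transpose_expectation_Z[OF A]
    by (simp add: scaleR_add_right del: transpose_matrix_vector)
  also have "?S (?EX - ?y) = (?S ^^ Suc k) (x0 - ?y) - (real k / ?F) *\<^sub>R (?S ^^ k) ?u"
    unfolding Suc by (cases k) (simp_all add: S.diff S.scaleR del: transpose_matrix_vector)
  finally show ?case by (simp add: add_divide_distrib scaleR_add_left del: transpose_matrix_vector)
qed

end

section \<open>The error bound\<close>

theorem theorem4p4:
  fixes A At :: "real ^ 'n ^ 'm" and b bt :: "real ^ 'm" and x0 :: "real ^ 'n"
    and M :: "'w measure" and J :: "nat \<Rightarrow> 'w \<Rightarrow> 'n" and I :: "nat \<Rightarrow> 'w \<Rightarrow> 'm" and k :: nat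
  defines "xLS \<equiv> pinv A *v b"
    and "xLSt \<equiv> pinv At *v bt"
    and "\<alpha> \<equiv> 1 - (sigma_min At)\<^sup>2 / (frobenius_norm At)\<^sup>2"
    and "\<beta> \<equiv> 1 - (1 - (sigma_max At)\<^sup>2 / (frobenius_norm At)\<^sup>2) ^ k"
  assumes "At \<noteq> 0"
    and "rek_draws M At J I"
    and "k \<ge> 1"
  shows "norm (\<integral>\<omega>. (rek_x At bt x0 (\<lambda>l. J l \<omega>) (\<lambda>l. I l \<omega>) k - xLS) \<partial>M)
      \<le> \<alpha> ^ k * norm (orth_proj (range_space (transpose At)) (x0 - xLS))
        + real k * \<alpha> ^ (k - 1) * (norm (transpose At *v bt) / (frobenius_norm At)\<^sup>2)
        + \<beta> * norm (orth_proj (range_space (transpose At)) (xLS - xLSt))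
        + norm (orth_proj (null_space At) (x0 - xLS))"
proof -
  interpret rek_draws M At J I by fact
  let ?R = "orth_proj (range_space (transpose At))" and ?N = "orth_proj (null_space At)"
    and ?Sk = "mean_step At ^^ k" and ?F = "(frobenius_norm At)\<^sup>2" and ?u = "transpose At *v bt"
  interpret Sk: linear ?Sk by (rule linear_mean_step_funpow)
  have split: "x = ?R x + ?N x" for x by (simp add: orth_proj_null_space)
  have R: "?R x \<in> range_space (transpose At)" and N: "?N x \<in> null_space At" for x
    by (simp_all add: orth_proj_in subspace_range_space subspace_null_space)
  \<comment> \<open>The mean step fixes the null space pointwise, hence the last term of the bound does not decay.\<close>
  have Sk: "?Sk x = ?Sk (?R x) + ?N x" for x
    using Sk.add[of "?R x" "?N x"] split[of x] mean_step_funpow_null[OF N, of k x] by simp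
  have triangle: "norm (p + q - r - s) \<le> norm p + norm q + norm r + norm s" for p q r s :: "real ^ 'n"
    by norm
  let ?d = "x0 - xLS" and ?w = "xLS - xLSt"
  have "(\<integral>\<omega>. (rek_x At bt x0 (\<lambda>l. J l \<omega>) (\<lambda>l. I l \<omega>) k - xLS) \<partial>M)
      = (\<integral>\<omega>. X bt x0 k \<omega> \<partial>M) - xLS"
    using integrable_X[of bt x0 k] by (simp add: X_def[abs_def] prob_space)
  also have "\<dots> = ?Sk (?d + ?w) - (real k / ?F) *\<^sub>R (mean_step At ^^ (k - 1)) ?u - ?w"
    using expectation_X[OF \<open>At \<noteq> 0\<close>, of bt x0 k] unfolding xLSt_def by (simp add: algebra_simps)
  \<comment> \<open>The null space component of \<open>?w\<close> cancels, so only its row space component needs a bound.\<close>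
  also have "\<dots> = ?Sk (?R ?d) + ?N ?d - (real k / ?F) *\<^sub>R (mean_step At ^^ (k - 1)) ?u
      - (?R ?w - ?Sk (?R ?w))"
    unfolding Sk.add Sk[of ?d] Sk[of ?w] using split[of ?w] by (simp add: algebra_simps)
  finally have "norm (\<integral>\<omega>. (rek_x At bt x0 (\<lambda>l. J l \<omega>) (\<lambda>l. I l \<omega>) k - xLS) \<partial>M)
      \<le> norm (?Sk (?R ?d)) + norm (?N ?d) + norm ((real k / ?F) *\<^sub>R (mean_step At ^^ (k - 1)) ?u)
        + norm (?R ?w - ?Sk (?R ?w))"
    by (simp only: triangle)
  moreover have "norm (?Sk (?R ?d)) \<le> \<alpha> ^ k * norm (?R ?d)"
    unfolding \<alpha>_def by (rule mean_step_funpow_range_le[OF \<open>At \<noteq> 0\<close> R])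
  moreover have "norm (?R ?w - ?Sk (?R ?w)) \<le> \<beta> * norm (?R ?w)"
    unfolding \<beta>_def by (rule mean_step_funpow_range_diff_le[OF \<open>At \<noteq> 0\<close> R])
  moreover have "norm ((real k / ?F) *\<^sub>R (mean_step At ^^ (k - 1)) ?u)
      \<le> real k * \<alpha> ^ (k - 1) * (norm ?u / ?F)"
  proof -
    have "?u \<in> range_space (transpose At)" unfolding range_space_def by (rule rangeI)
    then have "norm ((mean_step At ^^ (k - 1)) ?u) \<le> \<alpha> ^ (k - 1) * norm ?u"
      unfolding \<alpha>_def by (rule mean_step_funpow_range_le[OF \<open>At \<noteq> 0\<close>])
    from mult_left_mono[OF this, of "real k / ?F"] show ?thesis
      by (simp add: mult_ac del: transpose_matrix_vector)
  qed
  ultimately show ?thesis by linarith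
qed

end
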